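(* Let $a,b\in[0,\infty)$ and suppose the move costs are $w_{n,k}=\alpha_n=a+bn$ for all $n\in\mathbb{N}_0$ and all $k\in T=\{0,1,2\}$. Let $t_n$ denote the common value $d_{n,0}=d_{n,1}=d_{n,2}$ of the minimal costs. Then for all $n\in\mathbb{N}_0$, $$t_n=\sum_{\nu=0}^{n-1}2^{n-1-\nu}(a+b\nu)=a(2^n-1)+b\bigl(2^n-n-1\bigr).$$
   Context: Weighted Tower of Hanoi: $\mathbb{N}_0$ denotes the nonnegative integers; $T=\{0,1,2\}$ is the set of pegs; discs are labelled $1,2,3,\dots$ by increasing size. A state with $n$ discs is an assignment of the discs $1,\dots,n$ to the pegs, the discs on each peg being stacked with smaller discs above larger ones. A legal move transfers the topmost (smallest) disc of one peg to a different peg carrying no smaller disc. For $i\in T$, $i^n$ is the perfect state with all $n$ discs on peg $i$. For $\{i,j,k\}=T$ and $n\in\mathbb{N}_0$, $w_{n,k}\in[0,\infty)$ is a given cost of a single move of disc $n+1$ between pegs $i$ and $j$ (in either direction), and $d_{n,k}$ is the minimal total cost, over all finite sequences of legal moves, of getting from $i^n$ to $j^n$ with $n$ discs. When the costs do not depend on $k$, the values $d_{n,0},d_{n,1},d_{n,2}$ coincide. An empty sum is zero. *)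

theory Defs
  imports Complex_Main "HOL-Library.FuncSet"
begin

definition pegs :: "nat set" where
  "pegs = {0, 1, 2}"

text \<open>A state maps each disc in \<open>{1..n}\<close> to its peg. Since the discs on a peg are always
  stacked by size, this determines the configuration.\<close>

definition states :: "nat \<Rightarrow> (nat \<Rightarrow> nat) set" where
  "states n = ({1..n} \<rightarrow>\<^sub>E pegs)"

definition perfect :: "nat \<Rightarrow> nat \<Rightarrow> (nat \<Rightarrow> nat)" where
  "perfect n i = (\<lambda>m\<in>{1..n}. i)"

text \<open>\<open>legal_move w n s c s'\<close>: some disc \<open>m\<close>, topmost on its peg \<open>i\<close>, is moved to a different
  peg \<open>j\<close> carrying no smaller disc, at cost \<open>c\<close>. The cost is indexed by the peg \<open>k\<close> not involved
  in the move, and \<open>w n k\<close> is the cost for disc \<open>n + 1\<close>; hence \<open>w (m - 1) k\<close> for disc \<open>m\<close>.\<close>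

definition legal_move ::
    "(nat \<Rightarrow> nat \<Rightarrow> real) \<Rightarrow> nat \<Rightarrow> (nat \<Rightarrow> nat) \<Rightarrow> real \<Rightarrow> (nat \<Rightarrow> nat) \<Rightarrow> bool" where
  "legal_move w n s c s' \<longleftrightarrow>
     s \<in> states n \<and>
     (\<exists>m\<in>{1..n}. \<exists>i j k. {i, j, k} = pegs \<and> s m = i \<and>
        (\<forall>l\<in>{1..n}. l < m \<longrightarrow> s l \<noteq> i \<and> s l \<noteq> j) \<and>
        s' = s(m := j) \<and> c = w (m - 1) k)"

text \<open>\<open>walk w n s c s'\<close>: some finite sequence of legal moves of total cost \<open>c\<close> leads from
  \<open>s\<close> to \<open>s'\<close>.\<close>

inductive walk ::
    "(nat \<Rightarrow> nat \<Rightarrow> real) \<Rightarrow> nat \<Rightarrow> (nat \<Rightarrow> nat) \<Rightarrow> real \<Rightarrow> (nat \<Rightarrow> nat) \<Rightarrow> bool"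
  for w :: "nat \<Rightarrow> nat \<Rightarrow> real" and n :: nat where
  walk_refl: "s \<in> states n \<Longrightarrow> walk w n s 0 s"
| walk_step: "legal_move w n s c s' \<Longrightarrow> walk w n s' C s'' \<Longrightarrow> walk w n s (c + C) s''"

definition is_min_cost ::
    "(nat \<Rightarrow> nat \<Rightarrow> real) \<Rightarrow> nat \<Rightarrow> (nat \<Rightarrow> nat) \<Rightarrow> (nat \<Rightarrow> nat) \<Rightarrow> real \<Rightarrow> bool" where
  "is_min_cost w n s s' c \<longleftrightarrow> walk w n s c s' \<and> (\<forall>c'. walk w n s c' s' \<longrightarrow> c \<le> c')"

text \<open>For a given \<open>k\<close> there are two choices of \<open>(i, j)\<close>; the value is required to be the attained
  minimum for both. It exists for nonnegative costs, because the state graph is finite and connected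
  and every move can be reversed at the same cost.\<close>

definition min_cost :: "(nat \<Rightarrow> nat \<Rightarrow> real) \<Rightarrow> nat \<Rightarrow> nat \<Rightarrow> real" where
  "min_cost w n k =
     (THE c. \<forall>i j. {i, j, k} = pegs \<longrightarrow> is_min_cost w n (perfect n i) (perfect n j) c)"

end

theory Submission
  imports Defs
begin

text \<open>
  If the cost of a move depends only on the disc, the optimal strategy is the classical recursive
  one: transfer the \<open>n\<close> smaller discs to the spare peg, move disc \<open>n + 1\<close>, and transfer the
  smaller discs on top of it. Its cost satisfies \<open>t (n + 1) = 2 * t n + \<alpha> n\<close>, which unfolds to the
  sum; for affine \<open>\<alpha>\<close> the closed form follows by induction.

  That no walk is cheaper is shown with a potential function instead of an analysis of when the
  largest disc moves. To each state \<open>s\<close> and target peg \<open>p\<close> a number \<open>dist_to_perfect \<alpha> n s p\<close> is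
  attached, which is the cost of the greedy strategy from \<open>s\<close>: if disc \<open>n\<close> is not yet on \<open>p\<close>,
  gather the smaller discs on the third peg, move disc \<open>n\<close> once, and transfer a full tower. It
  vanishes at the perfect state on \<open>p\<close> and equals \<open>t n\<close> at the other two perfect states.
  A legal move lowers it by at most the cost of the move
  (\<open>dist_to_perfect_move\<close>): when disc \<open>n + 1\<close> moves, the smaller discs must all lie on one peg, so
  the potential is known explicitly on both sides, and the moves of smaller discs are covered by
  induction. Summing along a walk bounds its cost from below by the difference of the potentials of
  its ends.
\<close>

section \<open>The cost recursion, pegs and states\<close>

primrec tower_cost :: "(nat \<Rightarrow> real) \<Rightarrow> nat \<Rightarrow> real" where
  "tower_cost \<alpha> 0 = 0"
| "tower_cost \<alpha> (Suc n) = 2 * tower_cost \<alpha> n + \<alpha> n"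

lemma tower_cost_eq_sum: "tower_cost \<alpha> n = (\<Sum>\<nu><n. 2 ^ (n - 1 - \<nu>) * \<alpha> \<nu>)"
proof (induction n)
  case (Suc n)
  have "2 ^ (n - \<nu>) = (2::real) * 2 ^ (n - 1 - \<nu>)" if "\<nu> < n" for \<nu>
    using that by (simp flip: power_Suc add: Suc_diff_Suc)
  then have "(\<Sum>\<nu><n. 2 ^ (n - \<nu>) * \<alpha> \<nu>) = 2 * (\<Sum>\<nu><n. 2 ^ (n - 1 - \<nu>) * \<alpha> \<nu>)"
    by (simp add: sum_distrib_left mult.assoc)
  then show ?case
    using Suc by simp
qed simp

lemma tower_cost_affine:
  "tower_cost (\<lambda>m. a + b * real m) n = a * (2 ^ n - 1) + b * (2 ^ n - real n - 1)"
  by (induction n) (simp_all add: algebra_simps)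

lemma pegs_triple_iff:
  "{i, j, k} = pegs \<longleftrightarrow> i \<in> pegs \<and> j \<in> pegs \<and> i \<noteq> j \<and> k = 3 - (i + j)"
proof
  assume eq: "{i, j, k} = pegs"
  then have in_pegs: "i \<in> pegs" "j \<in> pegs" "k \<in> pegs"
    by auto
  have "0 \<in> {i, j, k}" "1 \<in> {i, j, k}" "2 \<in> {i, j, k}"
    unfolding eq by (simp_all add: pegs_def)
  then have "0 = i \<or> 0 = j \<or> 0 = k" "1 = i \<or> 1 = j \<or> 1 = k" "2 = i \<or> 2 = j \<or> 2 = k"
    by simp_all
  with in_pegs have "i \<noteq> j \<and> k = 3 - (i + j)"
    unfolding pegs_def by (elim insertE emptyE) simp_all
  with in_pegs show "i \<in> pegs \<and> j \<in> pegs \<and> i \<noteq> j \<and> k = 3 - (i + j)"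
    by simp
next
  assume "i \<in> pegs \<and> j \<in> pegs \<and> i \<noteq> j \<and> k = 3 - (i + j)"
  then have "i \<in> {0, 1, 2}" "j \<in> {0, 1, 2}" "i \<noteq> j" "k = 3 - (i + j)"
    by (simp_all add: pegs_def)
  then show "{i, j, k} = pegs"
    unfolding pegs_def by (elim insertE emptyE) (simp_all add: insert_commute)
qed

lemma third_peg:
  assumes "p \<in> pegs" "q \<in> pegs" "p \<noteq> q"
  shows "3 - (p + q) \<in> pegs" "3 - (p + q) \<noteq> p" "3 - (p + q) \<noteq> q"
  using assms by (auto simp: pegs_def)

lemma perfect_Suc: "perfect (Suc n) i = (perfect n i)(Suc n := i)"
  by (auto simp: perfect_def fun_eq_iff)

lemma perfect_in_states: "i \<in> pegs \<Longrightarrow> perfect n i \<in> states n"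
  by (simp add: perfect_def states_def)

lemma states_add_disc: "s \<in> states n \<Longrightarrow> p \<in> pegs \<Longrightarrow> s(Suc n := p) \<in> states (Suc n)"
  by (auto simp: states_def PiE_iff extensional_def)

section \<open>The recursive strategy\<close>

lemma walk_trans: "walk w n s c s' \<Longrightarrow> walk w n s' c' s'' \<Longrightarrow> walk w n s (c + c') s''"
  by (induction rule: walk.induct) (auto simp: add.assoc intro: walk_step)

text \<open>A larger disc lying at the bottom of a peg does not obstruct any smaller one.\<close>

lemma legal_move_add_disc:
  assumes "legal_move w n s c s'" and "p \<in> pegs"
  shows "legal_move w (Suc n) (s(Suc n := p)) c (s'(Suc n := p))"
proof -
  obtain m i j k where m: "m \<in> {1..n}" "{i, j, k} = pegs" "s m = i"
      "\<forall>l\<in>{1..n}. l < m \<longrightarrow> s l \<noteq> i \<and> s l \<noteq> j" "s' = s(m := j)" "c = w (m - 1) k"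
    and s: "s \<in> states n"
    using assms(1) unfolding legal_move_def by blast
  have "(s(Suc n := p)) m = i" "m \<in> {1..Suc n}"
    "\<forall>l\<in>{1..Suc n}. l < m \<longrightarrow> (s(Suc n := p)) l \<noteq> i \<and> (s(Suc n := p)) l \<noteq> j"
    "s'(Suc n := p) = (s(Suc n := p))(m := j)"
    using m by (auto simp: fun_upd_twist)
  then show ?thesis
    unfolding legal_move_def using states_add_disc[OF s assms(2)] m(2,6) by blast
qed

lemma walk_add_disc:
  assumes "walk w n s c s'" and "p \<in> pegs"
  shows "walk w (Suc n) (s(Suc n := p)) c (s'(Suc n := p))"
  using assms
  by (induction rule: walk.induct) (auto intro: walk.intros states_add_disc legal_move_add_disc)

lemma walk_tower_cost:
  assumes w: "\<And>m k. k \<in> pegs \<Longrightarrow> w m k = \<alpha> m"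
    and "i \<in> pegs" "j \<in> pegs" "i \<noteq> j"
  shows "walk w n (perfect n i) (tower_cost \<alpha> n) (perfect n j)"
  using assms(2-)
proof (induction n arbitrary: i j)
  case 0
  have "perfect 0 i = perfect 0 j"
    by (simp add: perfect_def fun_eq_iff)
  then show ?case
    using perfect_in_states[OF "0.prems"(1), of 0] by (auto intro: walk_refl)
next
  case (Suc n)
  define k where "k = 3 - (i + j)"
  have ijk: "{i, j, k} = pegs"
    using Suc.prems by (simp add: pegs_triple_iff k_def)
  then have k: "k \<in> pegs" "k \<noteq> i" "k \<noteq> j"
    using Suc.prems third_peg by (simp_all add: k_def)
  let ?st = "\<lambda>q r. (perfect n q)(Suc n := r)"
  have up: "walk w (Suc n) (?st i i) (tower_cost \<alpha> n) (?st k i)"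
    using Suc k by (intro walk_add_disc) auto
  have down: "walk w (Suc n) (?st k j) (tower_cost \<alpha> n) (?st j j)"
    using Suc k by (intro walk_add_disc) auto
  have "legal_move w (Suc n) (?st k i) (\<alpha> n) (?st k j)"
    unfolding legal_move_def
  proof (intro conjI bexI exI)
    show "?st k i \<in> states (Suc n)"
      using Suc.prems k by (intro states_add_disc perfect_in_states)
    show "\<forall>l\<in>{1..Suc n}. l < Suc n \<longrightarrow> ?st k i l \<noteq> i \<and> ?st k i l \<noteq> j"
      using k by (auto simp: perfect_def)
    show "\<alpha> n = w (Suc n - 1) k"
      using w k by simp
  qed (use ijk in auto)
  from walk_trans[OF up walk_step[OF this down]]
  have "walk w (Suc n) (?st i i) (tower_cost \<alpha> (Suc n)) (?st j j)"
    by (simp add: algebra_simps)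
  then show ?case
    by (simp only: perfect_Suc)
qed

section \<open>The lower bound\<close>

text \<open>\<open>3 - (s (Suc n) + p)\<close> is the peg different from both \<open>s (Suc n)\<close> and \<open>p\<close>, where the smaller
  discs have to be gathered.\<close>

primrec dist_to_perfect :: "(nat \<Rightarrow> real) \<Rightarrow> nat \<Rightarrow> (nat \<Rightarrow> nat) \<Rightarrow> nat \<Rightarrow> real" where
  "dist_to_perfect \<alpha> 0 s p = 0"
| "dist_to_perfect \<alpha> (Suc n) s p =
     (if s (Suc n) = p then dist_to_perfect \<alpha> n s p
      else dist_to_perfect \<alpha> n s (3 - (s (Suc n) + p)) + \<alpha> n + tower_cost \<alpha> n)"

lemma dist_to_perfect_cong:
  "(\<And>l. l \<in> {1..n} \<Longrightarrow> s l = s' l) \<Longrightarrow> dist_to_perfect \<alpha> n s p = dist_to_perfect \<alpha> n s' p"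
  by (induction n arbitrary: p) auto

lemma dist_to_perfect_tower:
  assumes "\<And>l. l \<in> {1..n} \<Longrightarrow> s l = q" and "q \<in> pegs" "p \<in> pegs"
  shows "dist_to_perfect \<alpha> n s p = (if q = p then 0 else tower_cost \<alpha> n)"
  using assms
proof (induction n arbitrary: p)
  case (Suc n)
  have "3 - (q + p) \<in> pegs \<and> 3 - (q + p) \<noteq> q" if "q \<noteq> p"
    using that Suc.prems(2,3) third_peg by simp
  then show ?case
    using Suc by auto
qed simp

text \<open>For a move of the largest disc, the only loss in the potential occurs when the disc goes to
  the target peg, and then it is exactly the cost of the move. Going between the two other pegs
  leaves the potential unchanged and leaving the target peg does not lower it, so that
  nonnegativity of the costs suffices.\<close>

lemma dist_to_perfect_move:
  assumes \<alpha>: "\<And>m. 0 \<le> \<alpha> m"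
    and "\<And>l. l \<in> {1..n} \<Longrightarrow> s l \<in> pegs"
    and "m \<in> {1..n}" "s m \<noteq> j" "j \<in> pegs"
    and "\<And>l. l \<in> {1..n} \<Longrightarrow> l < m \<Longrightarrow> s l \<noteq> s m \<and> s l \<noteq> j"
    and "p \<in> pegs"
  shows "dist_to_perfect \<alpha> n s p \<le> \<alpha> (m - 1) + dist_to_perfect \<alpha> n (s(m := j)) p"
proof -
  define s' where "s' = s(m := j)"
  then have s': "s' m = j" "\<And>l. l \<noteq> m \<Longrightarrow> s' l = s l"
    by simp_all
  have "dist_to_perfect \<alpha> n s p \<le> \<alpha> (m - 1) + dist_to_perfect \<alpha> n s' p"
    using assms(2-)
  proof (induction n arbitrary: p)
    case (Suc n)
    have last: "s (Suc n) \<in> pegs"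
      using Suc.prems(1) by simp
    show ?case
    proof (cases "m = Suc n")
      case False
      have IH: "dist_to_perfect \<alpha> n s q \<le> \<alpha> (m - 1) + dist_to_perfect \<alpha> n s' q"
        if "q \<in> pegs" for q
        using Suc.prems False that by (intro Suc.IH) auto
      have "s' (Suc n) = s (Suc n)"
        using False s'(2) by simp
      then show ?thesis
        using IH[OF Suc.prems(6)] IH[OF third_peg(1)[OF last Suc.prems(6)]] by simp
    next
      case True
      define i where "i = s m"
      define k where "k = 3 - (i + j)"
      have ij: "i \<in> pegs" "j \<in> pegs" "i \<noteq> j"
        using Suc.prems last True by (simp_all add: i_def)
      then have k: "k \<in> pegs" "k \<noteq> i" "k \<noteq> j" and pegs_eq: "{i, j, k} = pegs"
        using third_peg by (simp_all add: k_def pegs_triple_iff)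
      have on_k: "s l = k" if "l \<in> {1..n}" for l
      proof -
        have "s l \<in> {i, j, k}" "s l \<noteq> i" "s l \<noteq> j"
          unfolding pegs_eq using Suc.prems(1)[of l] Suc.prems(5)[of l] that True
          by (simp_all add: i_def)
        then show ?thesis
          by simp
      qed
      have before: "dist_to_perfect \<alpha> n s q = (if k = q then 0 else tower_cost \<alpha> n)"
        if "q \<in> pegs" for q
        using on_k k(1) that by (rule dist_to_perfect_tower)
      have after: "dist_to_perfect \<alpha> n s' q = dist_to_perfect \<alpha> n s q" for q
        using True s'(2) by (intro dist_to_perfect_cong) auto
      have thirds: "3 - (i + j) = k" "3 - (j + i) = k" "3 - (i + k) = j" "3 - (j + k) = i"
        using pegs_eq by (metis insert_commute pegs_triple_iff)+
      have ends: "s (Suc n) = i" "s' (Suc n) = j"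
        using True s'(1) by (simp_all add: i_def)
      consider "p = i" | "p = j" | "p = k"
        using Suc.prems(6) unfolding pegs_eq[symmetric] by blast
      then show ?thesis
        using ij k thirds ends \<alpha>[of n] True
        by cases (simp_all add: after before)
    qed
  qed simp
  then show ?thesis
    by (simp only: s'_def)
qed

lemma dist_to_perfect_le_walk_cost:
  assumes "\<And>m. 0 \<le> \<alpha> m" and w: "\<And>m k. k \<in> pegs \<Longrightarrow> w m k = \<alpha> m" and p: "p \<in> pegs"
    and "walk w n s c s'"
  shows "dist_to_perfect \<alpha> n s p \<le> c + dist_to_perfect \<alpha> n s' p"
  using assms(4)
proof (induction rule: walk.induct)
  case (walk_step s c s' C s'')
  obtain m i j k where m: "m \<in> {1..n}" "{i, j, k} = pegs" "s m = i"
      "\<forall>l\<in>{1..n}. l < m \<longrightarrow> s l \<noteq> i \<and> s l \<noteq> j" "s' = s(m := j)" "c = w (m - 1) k"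
    and s: "s \<in> states n"
    using walk_step.hyps(1) unfolding legal_move_def by blast
  have "i \<noteq> j" "j \<in> pegs" "k \<in> pegs"
    using m(2) third_peg by (simp_all add: pegs_triple_iff)
  moreover have "s l \<in> pegs" if "l \<in> {1..n}" for l
    using s that by (auto simp: states_def)
  ultimately have "dist_to_perfect \<alpha> n s p \<le> \<alpha> (m - 1) + dist_to_perfect \<alpha> n s' p"
    unfolding m(5) using m(1,3,4) p assms(1) by (intro dist_to_perfect_move) auto
  then show ?case
    using walk_step.IH w[OF \<open>k \<in> pegs\<close>] m(6) by simp
qed simp

section \<open>The minimal cost\<close>

lemma is_min_cost_tower:
  assumes "\<And>m. 0 \<le> \<alpha> m" and "\<And>m k. k \<in> pegs \<Longrightarrow> w m k = \<alpha> m"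
    and "i \<in> pegs" "j \<in> pegs" "i \<noteq> j"
  shows "is_min_cost w n (perfect n i) (perfect n j) (tower_cost \<alpha> n)"
  unfolding is_min_cost_def
proof (intro conjI allI impI)
  show "walk w n (perfect n i) (tower_cost \<alpha> n) (perfect n j)"
    using assms(2-) by (rule walk_tower_cost)
next
  fix c assume "walk w n (perfect n i) c (perfect n j)"
  with assms have "dist_to_perfect \<alpha> n (perfect n i) j
      \<le> c + dist_to_perfect \<alpha> n (perfect n j) j"
    by (intro dist_to_perfect_le_walk_cost)
  moreover have "dist_to_perfect \<alpha> n (perfect n q) j = (if q = j then 0 else tower_cost \<alpha> n)"
    if "q \<in> pegs" for q
    using that assms(4) by (intro dist_to_perfect_tower) (auto simp: perfect_def)
  ultimately show "tower_cost \<alpha> n \<le> c"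
    using assms(3-) by simp
qed

lemma is_min_cost_unique: "is_min_cost w n s s' c \<Longrightarrow> is_min_cost w n s s' c' \<Longrightarrow> c = c'"
  by (simp add: is_min_cost_def antisym)

lemma min_cost_eq_tower_cost:
  assumes "\<And>m. 0 \<le> \<alpha> m" and "\<And>m k. k \<in> pegs \<Longrightarrow> w m k = \<alpha> m" and k: "k \<in> pegs"
  shows "min_cost w n k = tower_cost \<alpha> n"
  unfolding min_cost_def
proof (rule the_equality)
  show min: "\<forall>i j. {i, j, k} = pegs \<longrightarrow>
      is_min_cost w n (perfect n i) (perfect n j) (tower_cost \<alpha> n)"
    using assms(1,2) by (simp add: pegs_triple_iff is_min_cost_tower)
  fix c
  assume c: "\<forall>i j. {i, j, k} = pegs \<longrightarrow> is_min_cost w n (perfect n i) (perfect n j) c"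
  \<comment> \<open>Uniqueness of the cost needs an actual pair of pegs besides \<open>k\<close>.\<close>
  obtain i j where "{i, j, k} = pegs"
    using k that[of 1 2] that[of 0 2] that[of 0 1] by (auto simp: pegs_def)
  then have "is_min_cost w n (perfect n i) (perfect n j) c"
    "is_min_cost w n (perfect n i) (perfect n j) (tower_cost \<alpha> n)"
    using c min by simp_all
  then show "c = tower_cost \<alpha> n"
    by (rule is_min_cost_unique)
qed

theorem proposition4:
  fixes a b :: real and w :: "nat \<Rightarrow> nat \<Rightarrow> real" and n :: nat
  assumes "0 \<le> a" and "0 \<le> b"
    and "\<And>m k. k \<in> pegs \<Longrightarrow> w m k = a + b * real m"
  shows "(\<forall>k\<in>pegs. min_cost w n k = (\<Sum>\<nu><n. 2 ^ (n - 1 - \<nu>) * (a + b * real \<nu>))) \<and>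
         (\<Sum>\<nu><n. 2 ^ (n - 1 - \<nu>) * (a + b * real \<nu>)) =
           a * (2 ^ n - 1) + b * (2 ^ n - real n - 1)"
  unfolding tower_cost_eq_sum[symmetric]
  using assms by (auto intro: min_cost_eq_tower_cost tower_cost_affine)

end
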